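(* Let $n,R$ be positive integers, $\boldsymbol{a}_1,\dots,\boldsymbol{a}_R\in\mathbb{R}^n$, $r_1,\dots,r_R>0$ and $\epsilon>0$. Let $\{(\boldsymbol{y}^{(k)},\boldsymbol{w}^{(k)})\}_{k\ge 1}$ be any sequence of iterates generated by the SR-IRLS algorithm (defined in the context) from these data. Then the sequence of objective values $\{\mathcal{J}(\boldsymbol{y}^{(k)},\boldsymbol{w}^{(k)})\}_{k\ge1}$ converges to a (finite) constant, and every limit point of the iterates $\{(\boldsymbol{y}^{(k)},\boldsymbol{w}^{(k)})\}_{k\ge1}$ is a stationary point of the optimization problem $$\underset{\boldsymbol{y}\in\mathbb{R}^{n+1},\ \boldsymbol{w}\in\mathbb{R}^R}{\text{minimize}}\ \ \mathcal{J}(\boldsymbol{y},\boldsymbol{w})\quad\text{subject to}\quad \boldsymbol{y}^T\boldsymbol{D}\boldsymbol{y}+2\boldsymbol{f}^T\boldsymbol{y}=0,\quad w_i>0\ \ (i=1,\dots,R).$$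
   Context: Notation. For $i=1,\dots,R$ put $\tilde{\boldsymbol{a}}_i^T=[\,-2\boldsymbol{a}_i^T\ \ 1\,]\in\mathbb{R}^{1\times(n+1)}$ and $b_i=r_i^2-\|\boldsymbol{a}_i\|_2^2$. Let $\boldsymbol{A}\in\mathbb{R}^{R\times(n+1)}$ be the matrix with rows $\tilde{\boldsymbol{a}}_i^T$, $\boldsymbol{b}=(b_1,\dots,b_R)^T$, and $$\boldsymbol{D}=\begin{bmatrix}\boldsymbol{I}_n&\boldsymbol{0}_{n\times1}\\ \boldsymbol{0}_{1\times n}&0\end{bmatrix},\qquad \boldsymbol{f}=\begin{bmatrix}\boldsymbol{0}_{n\times1}\\-0.5\end{bmatrix}.$$ For $\boldsymbol{y}\in\mathbb{R}^{n+1}$ and $\boldsymbol{w}\in\mathbb{R}^R$ with all $w_i>0$, $$\mathcal{J}(\boldsymbol{y},\boldsymbol{w})=\sum_{i=1}^R w_i(\tilde{\boldsymbol{a}}_i^T\boldsymbol{y}-b_i)^2+\sum_{i=1}^R\left(\epsilon^2w_i-\ln w_i\right).$$ SR-IRLS algorithm. Initialize $w_i^{(0)}=1$ for all $i$. For $k=1,2,\dots$, with $\boldsymbol{W}^{(k-1)}=\mathrm{diag}(w_1^{(k-1)},\dots,w_R^{(k-1)})$: (1) $\boldsymbol{y}^{(k)}$ is a global minimizer of $(\boldsymbol{A}\boldsymbol{y}-\boldsymbol{b})^T\boldsymbol{W}^{(k-1)}(\boldsymbol{A}\boldsymbol{y}-\boldsymbol{b})$ over all $\boldsymbol{y}\in\mathbb{R}^{n+1}$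 with $\boldsymbol{y}^T\boldsymbol{D}\boldsymbol{y}+2\boldsymbol{f}^T\boldsymbol{y}=0$; equivalently, $\boldsymbol{y}^{(k)}$ satisfies this constraint and there is $\lambda\in\mathbb{R}$ with $(\boldsymbol{A}^T\boldsymbol{W}^{(k-1)}\boldsymbol{A}+\lambda\boldsymbol{D})\boldsymbol{y}^{(k)}=\boldsymbol{A}^T\boldsymbol{W}^{(k-1)}\boldsymbol{b}-\lambda\boldsymbol{f}$ and $\boldsymbol{A}^T\boldsymbol{W}^{(k-1)}\boldsymbol{A}+\lambda\boldsymbol{D}$ positive semidefinite. (2) $w_i^{(k)}=\dfrac{1}{(\tilde{\boldsymbol{a}}_i^T\boldsymbol{y}^{(k)}-b_i)^2+\epsilon^2}$ for $i=1,\dots,R$. The iteration is run indefinitely (no stopping rule). A limit point of a sequence is the limit of some convergent subsequence. A stationary point of the optimization problem is a feasible pair $(\boldsymbol{y}^*,\boldsymbol{w}^* )$ for which there is a multiplier $\lambda^*\in\mathbb{R}$ such that the derivatives of the Lagrangian $\mathcal{J}(\boldsymbol{y},\boldsymbol{w})+\lambda^*(\boldsymbol{y}^T\boldsymbol{D}\boldsymbol{y}+2\boldsymbol{f}^T\boldsymbol{y})$ with respect to $\boldsymbol{y}$ and to each $w_i$ vanish at $(\boldsymbol{y}^*,\boldsymbol{w}^* )$, i.e. $\boldsymbol{A}^T\boldsymbol{W}^*(\boldsymbol{A}\boldsymbol{y}^*-\boldsymbol{b})+\lambda^*(\boldsymbol{D}\boldsymbol{y}^*+\boldsymbol{f})=\boldsymbol{0}$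 with $\boldsymbol{W}^*=\mathrm{diag}(\boldsymbol{w}^* )$, and $(\tilde{\boldsymbol{a}}_i^T\boldsymbol{y}^*-b_i)^2+\epsilon^2-1/w_i^*=0$ for all $i$. *)

theory Defs
  imports "HOL-Analysis.Analysis"
begin

text \<open>
  The index type \<open>'n + 1\<close> has \<open>CARD('n) + 1\<close> elements: \<open>Inl k\<close> are the first \<open>n\<close> coordinates of a
  vector in \<open>real ^ ('n + 1)\<close> and \<open>Inr _\<close> (unique) is the last one.
\<close>

definition diag_mat :: "real ^ 'm \<Rightarrow> real ^ 'm ^ 'm" where
  "diag_mat w = (\<chi> i j. if i = j then w $ i else 0)"

definition a_tilde :: "real ^ 'n \<Rightarrow> real ^ ('n::finite + 1)" where
  "a_tilde a = (\<chi> j. case j of Inl k \<Rightarrow> - 2 * a $ k | Inr _ \<Rightarrow> 1)"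

definition A_mat :: "('r \<Rightarrow> real ^ 'n) \<Rightarrow> real ^ ('n::finite + 1) ^ 'r" where
  "A_mat a = (\<chi> i. a_tilde (a i))"

definition b_vec :: "('r \<Rightarrow> real ^ 'n) \<Rightarrow> ('r \<Rightarrow> real) \<Rightarrow> real ^ 'r" where
  "b_vec a r = (\<chi> i. (r i)\<^sup>2 - (norm (a i))\<^sup>2)"

definition D_mat :: "real ^ ('n::finite + 1) ^ ('n + 1)" where
  "D_mat = diag_mat (\<chi> j. case j of Inl _ \<Rightarrow> 1 | Inr _ \<Rightarrow> 0)"

definition f_vec :: "real ^ ('n::finite + 1)" where
  "f_vec = (\<chi> j. case j of Inl _ \<Rightarrow> 0 | Inr _ \<Rightarrow> - (1 / 2))"

definition constraint_fun :: "real ^ ('n::finite + 1) \<Rightarrow> real" where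
  "constraint_fun y = y \<bullet> (D_mat *v y) + 2 * (f_vec \<bullet> y)"

definition J_obj ::
  "('r \<Rightarrow> real ^ 'n) \<Rightarrow> ('r \<Rightarrow> real) \<Rightarrow> real \<Rightarrow> real ^ ('n::finite + 1) \<Rightarrow> real ^ 'r \<Rightarrow> real" where
  "J_obj a r \<epsilon> y w =
     (\<Sum>i\<in>UNIV. w $ i * (a_tilde (a i) \<bullet> y - b_vec a r $ i)\<^sup>2) +
     (\<Sum>i\<in>UNIV. \<epsilon>\<^sup>2 * w $ i - ln (w $ i))"

definition wls_cost ::
  "('r \<Rightarrow> real ^ 'n) \<Rightarrow> ('r \<Rightarrow> real) \<Rightarrow> real ^ 'r \<Rightarrow> real ^ ('n::finite + 1) \<Rightarrow> real" where
  "wls_cost a r w y =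
     (A_mat a *v y - b_vec a r) \<bullet> (diag_mat w *v (A_mat a *v y - b_vec a r))"

text \<open>
  A run consists of \<open>w 0, w 1, \<dots>\<close> and \<open>y 1, y 2, \<dots>\<close>; the value \<open>y 0\<close> is a dummy on which nothing
  is imposed. Minimizers need not be unique, so this is a relation and not a function of the data.
\<close>

definition SR_IRLS ::
  "('r \<Rightarrow> real ^ 'n) \<Rightarrow> ('r \<Rightarrow> real) \<Rightarrow> real \<Rightarrow>
   (nat \<Rightarrow> real ^ ('n::finite + 1)) \<Rightarrow> (nat \<Rightarrow> real ^ 'r) \<Rightarrow> bool" where
  "SR_IRLS a r \<epsilon> y w \<longleftrightarrow>
     (\<forall>i. w 0 $ i = 1) \<and>
     (\<forall>k\<ge>1.
        is_arg_min (wls_cost a r (w (k - 1))) (\<lambda>z. constraint_fun z = 0) (y k) \<and>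
        (\<forall>i. w k $ i = 1 / ((a_tilde (a i) \<bullet> y k - b_vec a r $ i)\<^sup>2 + \<epsilon>\<^sup>2)))"

definition lagrangian ::
  "('r \<Rightarrow> real ^ 'n) \<Rightarrow> ('r \<Rightarrow> real) \<Rightarrow> real \<Rightarrow> real \<Rightarrow> real ^ ('n::finite + 1) \<Rightarrow> real ^ 'r \<Rightarrow> real" where
  "lagrangian a r \<epsilon> \<mu> y w = J_obj a r \<epsilon> y w + \<mu> * constraint_fun y"

definition feasible :: "real ^ ('n::finite + 1) \<Rightarrow> real ^ 'r \<Rightarrow> bool" where
  "feasible y w \<longleftrightarrow> constraint_fun y = 0 \<and> (\<forall>i. w $ i > 0)"

definition stationary_point ::
  "('r \<Rightarrow> real ^ 'n) \<Rightarrow> ('r \<Rightarrow> real) \<Rightarrow> real \<Rightarrow> real ^ ('n::finite + 1) \<Rightarrow> real ^ 'r \<Rightarrow> bool" where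
  "stationary_point a r \<epsilon> y w \<longleftrightarrow>
     feasible y w \<and>
     (\<exists>\<mu>. GDERIV (\<lambda>z. lagrangian a r \<epsilon> \<mu> z w) y :> 0 \<and>
          (\<forall>i. ((\<lambda>t. lagrangian a r \<epsilon> \<mu> y (\<chi> j. if j = i then t else w $ j))
                 has_real_derivative 0) (at (w $ i))))"

text \<open>Limit of a convergent subsequence (unlike \<open>islimpt\<close>, values may repeat).\<close>

definition seq_limit_point :: "(nat \<Rightarrow> 'a::topological_space) \<Rightarrow> 'a \<Rightarrow> bool" where
  "seq_limit_point X l \<longleftrightarrow> (\<exists>s. strict_mono s \<and> (X \<circ> s) \<longlonglongrightarrow> l)"

lemma diag_mat_mult_nth: "(diag_mat w *v x) $ i = w $ i * x $ i"
  by (simp add: diag_mat_def matrix_vector_mult_def if_distrib[of "\<lambda>c. c * _"] cong: if_cong)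

lemma D_mat_symmetric: "(D_mat *v x) \<bullet> y = x \<bullet> (D_mat *v y)"
  by (simp add: D_mat_def inner_vec_def diag_mat_mult_nth mult_ac)

lemma transpose_A_mat_inner:
  "(transpose (A_mat a) *v x) \<bullet> h = (\<Sum>i\<in>UNIV. x $ i * (a_tilde (a i) \<bullet> h))"
proof -
  have "(transpose (A_mat a) *v x) \<bullet> h = x \<bullet> (A_mat a *v h)"
    by (metis dot_lmul_matrix transpose_matrix_vector)
  also have "\<dots> = (\<Sum>i\<in>UNIV. x $ i * (a_tilde (a i) \<bullet> h))"
    by (simp add: inner_vec_def A_mat_def matrix_vector_mult_def)
  finally show ?thesis .
qed

lemma A_mat_mult_nth: "(A_mat a *v y) $ i = a_tilde (a i) \<bullet> y"
  by (simp add: inner_vec_def A_mat_def matrix_vector_mult_def)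

lemma lagrangian_gderiv:
  "GDERIV (\<lambda>z. lagrangian a r \<epsilon> \<mu> z w) y :>
     2 *\<^sub>R (transpose (A_mat a) *v (diag_mat w *v (A_mat a *v y - b_vec a r))
          + \<mu> *\<^sub>R (D_mat *v y + f_vec))"
proof -
  have lin: "((\<lambda>z. D_mat *v z) has_derivative (\<lambda>h. D_mat *v h)) (at y)"
    by (simp add: bounded_linear_imp_has_derivative)
  have "((\<lambda>z. lagrangian a r \<epsilon> \<mu> z w) has_derivative
      (\<lambda>h. (\<Sum>i\<in>UNIV. w $ i * (2 * (a_tilde (a i) \<bullet> y - b_vec a r $ i) * (a_tilde (a i) \<bullet> h)))
         + \<mu> * (y \<bullet> (D_mat *v h) + h \<bullet> (D_mat *v y) + 2 * (f_vec \<bullet> h)))) (at y)"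
    unfolding lagrangian_def J_obj_def constraint_fun_def
    by (rule derivative_eq_intros lin refl)+ (simp add: fun_eq_iff algebra_simps)
  moreover have "(\<Sum>i\<in>UNIV. w $ i * (2 * (a_tilde (a i) \<bullet> y - b_vec a r $ i) * (a_tilde (a i) \<bullet> h)))
         + \<mu> * (y \<bullet> (D_mat *v h) + h \<bullet> (D_mat *v y) + 2 * (f_vec \<bullet> h)) =
      h \<bullet> (2 *\<^sub>R (transpose (A_mat a) *v (diag_mat w *v (A_mat a *v y - b_vec a r))
          + \<mu> *\<^sub>R (D_mat *v y + f_vec)))" for h
  proof -
    have "h \<bullet> (transpose (A_mat a) *v (diag_mat w *v (A_mat a *v y - b_vec a r))) =
        (\<Sum>i\<in>UNIV. w $ i * (a_tilde (a i) \<bullet> y - b_vec a r $ i) * (a_tilde (a i) \<bullet> h))"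
      unfolding inner_commute[of h] transpose_A_mat_inner
      by (simp add: diag_mat_mult_nth A_mat_mult_nth)
    moreover have "y \<bullet> (D_mat *v h) = h \<bullet> (D_mat *v y)"
      by (metis D_mat_symmetric inner_commute)
    moreover have "f_vec \<bullet> h = h \<bullet> f_vec"
      by (rule inner_commute)
    moreover have "(\<Sum>i\<in>UNIV. w $ i * (2 * (a_tilde (a i) \<bullet> y - b_vec a r $ i) * (a_tilde (a i) \<bullet> h))) =
        2 * (\<Sum>i\<in>UNIV. w $ i * (a_tilde (a i) \<bullet> y - b_vec a r $ i) * (a_tilde (a i) \<bullet> h))"
      unfolding sum_distrib_left by (intro sum.cong refl) algebra
    ultimately show ?thesis
      by (simp only: inner_scaleR_right inner_add_right) (simp add: algebra_simps)
  qed
  ultimately show ?thesis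
    unfolding gderiv_def by simp
qed

lemma lagrangian_weight_deriv:
  assumes "w $ i > 0"
  shows "((\<lambda>t. lagrangian a r \<epsilon> \<mu> y (\<chi> j. if j = i then t else w $ j)) has_real_derivative
           (a_tilde (a i) \<bullet> y - b_vec a r $ i)\<^sup>2 + \<epsilon>\<^sup>2 - 1 / w $ i) (at (w $ i))"
proof -
  define c where "c j = (a_tilde (a j) \<bullet> y - b_vec a r $ j)\<^sup>2" for j
  define d where "d = (\<Sum>j\<in>UNIV - {i}. w $ j * c j) + (\<Sum>j\<in>UNIV - {i}. \<epsilon>\<^sup>2 * w $ j - ln (w $ j))"
  have "lagrangian a r \<epsilon> \<mu> y (\<chi> j. if j = i then t else w $ j) =
      t * c i + (\<epsilon>\<^sup>2 * t - ln t) + d + \<mu> * constraint_fun y" for t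
    unfolding lagrangian_def J_obj_def
    by (subst (1 2) sum.remove[of UNIV i]) (simp_all add: d_def c_def)
  then show ?thesis
    using assms by (auto simp: c_def intro!: derivative_eq_intros)
qed

lemma stationary_point_iff:
  "stationary_point a r \<epsilon> y w \<longleftrightarrow>
     feasible y w \<and>
     (\<exists>\<mu>. transpose (A_mat a) *v (diag_mat w *v (A_mat a *v y - b_vec a r))
          + \<mu> *\<^sub>R (D_mat *v y + f_vec) = 0) \<and>
     (\<forall>i. (a_tilde (a i) \<bullet> y - b_vec a r $ i)\<^sup>2 + \<epsilon>\<^sup>2 - 1 / w $ i = 0)"
proof -
  have grad: "GDERIV (\<lambda>z. lagrangian a r \<epsilon> \<mu> z w) y :> 0 \<longleftrightarrow>
      transpose (A_mat a) *v (diag_mat w *v (A_mat a *v y - b_vec a r))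
        + \<mu> *\<^sub>R (D_mat *v y + f_vec) = 0" (is "_ \<longleftrightarrow> ?g = 0") for \<mu>
  proof
    assume "GDERIV (\<lambda>z. lagrangian a r \<epsilon> \<mu> z w) y :> 0"
    then have "(\<lambda>h. h \<bullet> 0) = (\<lambda>h. h \<bullet> (2 *\<^sub>R ?g))"
      using lagrangian_gderiv[of a r \<epsilon> \<mu> w y] unfolding gderiv_def
      by (rule has_derivative_unique)
    then have "?g \<bullet> (2 *\<^sub>R ?g) = 0"
      by (metis inner_zero_right)
    then show "?g = 0"
      by simp
  next
    assume "?g = 0"
    then show "GDERIV (\<lambda>z. lagrangian a r \<epsilon> \<mu> z w) y :> 0"
      using lagrangian_gderiv[of a r \<epsilon> \<mu> w y] by simp
  qed
  have weight: "((\<lambda>t. lagrangian a r \<epsilon> \<mu> y (\<chi> j. if j = i then t else w $ j))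
        has_real_derivative 0) (at (w $ i)) \<longleftrightarrow>
      (a_tilde (a i) \<bullet> y - b_vec a r $ i)\<^sup>2 + \<epsilon>\<^sup>2 - 1 / w $ i = 0"
    if "feasible y w" for \<mu> i
  proof -
    have "w $ i > 0"
      using that by (simp add: feasible_def)
    note deriv = lagrangian_weight_deriv[OF this, of a r \<epsilon> \<mu> y]
    show ?thesis
    proof
      assume "((\<lambda>t. lagrangian a r \<epsilon> \<mu> y (\<chi> j. if j = i then t else w $ j))
        has_real_derivative 0) (at (w $ i))"
      from DERIV_unique[OF deriv this]
      show "(a_tilde (a i) \<bullet> y - b_vec a r $ i)\<^sup>2 + \<epsilon>\<^sup>2 - 1 / w $ i = 0" .
    next
      assume *: "(a_tilde (a i) \<bullet> y - b_vec a r $ i)\<^sup>2 + \<epsilon>\<^sup>2 - 1 / w $ i = 0"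
      from deriv[unfolded *]
      show "((\<lambda>t. lagrangian a r \<epsilon> \<mu> y (\<chi> j. if j = i then t else w $ j))
        has_real_derivative 0) (at (w $ i))" .
    qed
  qed
  show ?thesis
    unfolding stationary_point_def grad using weight by blast
qed

end

theory Submission
  imports Defs
begin

text \<open>
  SR-IRLS is alternating minimization, and the argument is the one for majorization-minimization.
  Minimizing \<open>\<J>(y, w)\<close> over the weights leaves the robust loss
  \<open>\<phi>(y) = \<Sum>\<^sub>i (1 + ln (\<rho>\<^sub>i(y)\<^sup>2 + \<epsilon>\<^sup>2))\<close>, where \<open>\<rho>\<^sub>i(y)\<close> is the \<open>i\<close>-th residual (\<open>weights_majorize\<close>),
  and the reweighting step attains this minimum (\<open>reweighting_attains\<close>). Since \<open>y\<^sub>k\<^sub>+\<^sub>1\<close> minimizes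
  \<open>\<J>(\<cdot>, w\<^sub>k)\<close> on the constraint set, every feasible \<open>z\<close> satisfies
  \<open>\<phi>(y\<^sub>k\<^sub>+\<^sub>1) \<le> \<J>(y\<^sub>k\<^sub>+\<^sub>1, w\<^sub>k) \<le> \<J>(z, w\<^sub>k)\<close> (\<open>step_bound\<close>).

  For \<open>z = y\<^sub>k\<close> with \<open>k \<ge> 1\<close> the right-hand side is \<open>\<phi>(y\<^sub>k)\<close>, so the objective values \<open>\<phi>(y\<^sub>k)\<close> decrease; they are
  bounded below because \<open>\<epsilon> > 0\<close>, hence they converge to some \<open>L\<close> with \<open>L \<le> \<phi>(y\<^sub>k)\<close> for all \<open>k \<ge> 1\<close>.

  Along a subsequence converging to \<open>(y', w')\<close> the bound reads \<open>L \<le> \<J>(z, w\<^sub>k)\<close> for every fixed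
  feasible \<open>z\<close>. The limit gives \<open>\<J>(y', w') = \<phi>(y') = L \<le> \<J>(z, w')\<close>. So \<open>y'\<close> itself is a constrained
  global minimizer of \<open>\<J>(\<cdot>, w')\<close>, without any control of the shifted subsequence \<open>y\<^sub>k\<^sub>+\<^sub>1\<close>.
  The constraint surface is a paraboloid with nowhere vanishing gradient, so a minimizer has a
  Lagrange multiplier (\<open>constrained_minimizer_multiplier\<close>), and \<open>w'\<close> is stationary because it is the
  reweighting of \<open>y'\<close>.
\<close>

definition robust_loss ::
  "('r::finite \<Rightarrow> real ^ 'n) \<Rightarrow> ('r \<Rightarrow> real) \<Rightarrow> real \<Rightarrow> real ^ ('n::finite + 1) \<Rightarrow> real" where
  "robust_loss a r \<epsilon> y = (\<Sum>i\<in>UNIV. 1 + ln ((a_tilde (a i) \<bullet> y - b_vec a r $ i)\<^sup>2 + \<epsilon>\<^sup>2))"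

text \<open>
  For fixed weights the least-squares cost and the objective differ by a constant, so they have the
  same minimizers.
\<close>

lemma J_obj_eq_wls_cost:
  "J_obj a r \<epsilon> y w = wls_cost a r w y + (\<Sum>i\<in>UNIV. \<epsilon>\<^sup>2 * w $ i - ln (w $ i))"
  by (simp add: J_obj_def wls_cost_def inner_vec_def diag_mat_mult_nth A_mat_mult_nth
      power2_eq_square mult_ac)

lemma J_obj_eq_sum:
  "J_obj a r \<epsilon> y w =
     (\<Sum>i\<in>UNIV. w $ i * ((a_tilde (a i) \<bullet> y - b_vec a r $ i)\<^sup>2 + \<epsilon>\<^sup>2) - ln (w $ i))"
  by (simp add: J_obj_def sum.distrib[symmetric] algebra_simps)

text \<open>
  Each summand has the form \<open>w s - ln w\<close> with \<open>s > 0\<close>, and \<open>ln (w s) \<le> w s - 1\<close>; equality holds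
  exactly at \<open>w s = 1\<close>, which is the reweighting rule.
\<close>

lemma weights_majorize:
  assumes "\<epsilon> > 0" and "\<And>i. w $ i > 0"
  shows "robust_loss a r \<epsilon> y \<le> J_obj a r \<epsilon> y w"
  unfolding robust_loss_def J_obj_eq_sum
proof (rule sum_mono)
  fix i
  let ?s = "(a_tilde (a i) \<bullet> y - b_vec a r $ i)\<^sup>2 + \<epsilon>\<^sup>2"
  have s: "?s > 0"
    using assms(1) by (simp add: add_nonneg_pos)
  have "ln (w $ i * ?s) \<le> w $ i * ?s - 1"
    using assms(2) s by (intro ln_le_minus_one mult_pos_pos)
  then show "1 + ln ?s \<le> w $ i * ?s - ln (w $ i)"
    using assms(2)[of i] ln_mult_pos[OF assms(2)[of i] s] by linarith
qed

lemma reweighting_attains: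
  assumes "\<epsilon> > 0"
    and "\<And>i. w $ i = 1 / ((a_tilde (a i) \<bullet> y - b_vec a r $ i)\<^sup>2 + \<epsilon>\<^sup>2)"
  shows "J_obj a r \<epsilon> y w = robust_loss a r \<epsilon> y"
  unfolding robust_loss_def J_obj_eq_sum
proof (rule sum.cong[OF refl])
  fix i
  let ?s = "(a_tilde (a i) \<bullet> y - b_vec a r $ i)\<^sup>2 + \<epsilon>\<^sup>2"
  have s: "?s > 0"
    using assms(1) by (simp add: add_nonneg_pos)
  have "1 / x * x - ln (1 / x) = 1 + ln x" if "x > 0" for x :: real
    using that by (simp add: ln_div)
  from this[OF s] show "w $ i * ?s - ln (w $ i) = 1 + ln ?s"
    unfolding assms(2) .
qed

lemma robust_loss_ge:
  fixes a :: "'r::finite \<Rightarrow> real ^ 'n"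
  assumes "\<epsilon> > 0"
  shows "(\<Sum>i\<in>(UNIV::'r set). 1 + ln (\<epsilon>\<^sup>2)) \<le> robust_loss a r \<epsilon> y"
  unfolding robust_loss_def using assms by (intro sum_mono add_left_mono) (simp add: add_nonneg_pos)

text \<open>
  The vector \<open>f\<close> spans the axis of the paraboloid: the quadratic part of the constraint ignores it
  and the linear part does not.
\<close>

lemma D_mat_f_vec: "D_mat *v (f_vec :: real ^ ('n::finite + 1)) = 0"
  by (simp add: vec_eq_iff D_mat_def diag_mat_mult_nth f_vec_def split: sum.split)

lemma f_vec_inner_self: "(f_vec :: real ^ ('n::finite + 1)) \<bullet> f_vec = 1 / 4"
  unfolding inner_vec_def f_vec_def UNIV_Plus_UNIV[symmetric]
  by (subst sum.Plus) auto

lemma constraint_normal_nonzero: "D_mat *v y + f_vec \<noteq> 0"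
proof
  assume "D_mat *v y + f_vec = 0"
  then have "0 = (D_mat *v y + f_vec) \<bullet> f_vec"
    by simp
  also have "\<dots> = 1 / 4"
    by (simp add: inner_add_left D_mat_symmetric D_mat_f_vec f_vec_inner_self)
  finally show False
    by simp
qed

text \<open>
  Every tangent direction \<open>h\<close> is realized by a parabola in the constraint surface: the second-order
  error \<open>t\<^sup>2 h\<^sup>T D h\<close> of the straight line is compensated along the axis. Moving by \<open>- s f\<close> changes
  the constraint by \<open>- 2 s f\<^sup>T f = - s / 2\<close>, hence \<open>s = 2 t\<^sup>2 h\<^sup>T D h\<close>.
\<close>

lemma constraint_fun_parabola:
  assumes "constraint_fun y = 0" and "(D_mat *v y + f_vec) \<bullet> h = 0"
  shows "constraint_fun (y + t *\<^sub>R h - (2 * t\<^sup>2 * (h \<bullet> (D_mat *v h))) *\<^sub>R f_vec) = 0"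
proof -
  define s where "s = 2 * t\<^sup>2 * (h \<bullet> (D_mat *v h))"
  have D: "D_mat *v (y + t *\<^sub>R h - s *\<^sub>R f_vec) = D_mat *v y + t *\<^sub>R (D_mat *v h)"
    by (simp add: matrix_vector_right_distrib matrix_vector_mult_diff_distrib
        matrix_vector_mult_scaleR D_mat_f_vec)
  have f: "f_vec \<bullet> (D_mat *v x) = 0" for x :: "real ^ ('a + 1)"
    using D_mat_symmetric[of f_vec x] by (simp add: D_mat_f_vec)
  have sym: "y \<bullet> (D_mat *v h) = h \<bullet> (D_mat *v y)"
    by (metis D_mat_symmetric inner_commute)
  have "constraint_fun (y + t *\<^sub>R h - s *\<^sub>R f_vec) =
      constraint_fun y + 2 * t * ((D_mat *v y + f_vec) \<bullet> h) + t\<^sup>2 * (h \<bullet> (D_mat *v h)) - s / 2"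
    unfolding constraint_fun_def D
    by (simp add: inner_add_left inner_add_right inner_diff_left inner_diff_right f sym
        f_vec_inner_self inner_commute[of "D_mat *v y" h] power2_eq_square algebra_simps)
  then show ?thesis
    using assms by (simp add: s_def)
qed

text \<open>
  The derivative of the objective along each such parabola vanishes at a minimizer, so the gradient
  is orthogonal to all tangent directions and hence parallel to the normal. The multiplier comes
  from taking for \<open>h\<close> the tangential part of the gradient itself.
\<close>

lemma constrained_minimizer_multiplier:
  assumes feas: "constraint_fun y = 0"
    and min: "\<And>z. constraint_fun z = 0 \<Longrightarrow> J_obj a r \<epsilon> y w \<le> J_obj a r \<epsilon> z w"
  shows "\<exists>\<mu>. transpose (A_mat a) *v (diag_mat w *v (A_mat a *v y - b_vec a r))
              + \<mu> *\<^sub>R (D_mat *v y + f_vec) = 0"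
proof -
  define g where "g = transpose (A_mat a) *v (diag_mat w *v (A_mat a *v y - b_vec a r))"
  define n where "n = D_mat *v y + f_vec"
  have orth: "h \<bullet> g = 0" if "n \<bullet> h = 0" for h
  proof -
    define p where "p t = y + t *\<^sub>R h - (2 * t\<^sup>2 * (h \<bullet> (D_mat *v h))) *\<^sub>R f_vec" for t :: real
    have p0: "p 0 = y"
      by (simp add: p_def)
    have "(p has_vector_derivative h) (at 0)"
      unfolding p_def has_vector_derivative_def by (auto intro!: derivative_eq_intros)
    moreover have "((\<lambda>z. J_obj a r \<epsilon> z w) has_derivative (\<lambda>u. u \<bullet> (2 *\<^sub>R g))) (at (p 0))"
      using lagrangian_gderiv[of a r \<epsilon> 0 w y]
      by (simp add: gderiv_def lagrangian_def g_def p0)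
    ultimately have "((\<lambda>t. J_obj a r \<epsilon> (p t) w) has_derivative (\<lambda>t. (t *\<^sub>R h) \<bullet> (2 *\<^sub>R g))) (at 0)"
      unfolding has_vector_derivative_def using has_derivative_compose by blast
    then have "((\<lambda>t. J_obj a r \<epsilon> (p t) w) has_real_derivative 2 * (h \<bullet> g)) (at 0)"
      by (simp add: has_real_derivative_iff_has_vector_derivative has_vector_derivative_def mult_ac)
    moreover have "\<forall>t. \<bar>0 - t\<bar> < 1 \<longrightarrow> J_obj a r \<epsilon> (p 0) w \<le> J_obj a r \<epsilon> (p t) w"
      using min[OF constraint_fun_parabola[OF feas]] that by (simp add: p0 n_def p_def)
    ultimately have "2 * (h \<bullet> g) = 0"
      using DERIV_local_min zero_less_one by blast
    then show ?thesis
      by simp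
  qed
  define \<mu> where "\<mu> = - (n \<bullet> g) / (n \<bullet> n)"
  have "n \<bullet> n \<noteq> 0"
    using constraint_normal_nonzero by (simp add: n_def)
  then have tangent: "n \<bullet> (g + \<mu> *\<^sub>R n) = 0"
    by (simp add: \<mu>_def inner_add_right inner_diff_right)
  then have "(g + \<mu> *\<^sub>R n) \<bullet> g = 0"
    by (rule orth)
  with tangent have "(g + \<mu> *\<^sub>R n) \<bullet> (g + \<mu> *\<^sub>R n) = 0"
    unfolding inner_add_right[of "g + \<mu> *\<^sub>R n"] inner_scaleR_right
    by (simp add: inner_commute[of _ n])
  then have "g + \<mu> *\<^sub>R n = 0"
    by simp
  then show ?thesis
    unfolding g_def n_def by auto
qed

lemma SR_IRLS_weights:
  assumes "SR_IRLS a r \<epsilon> y w"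
  shows "w (Suc k) $ i = 1 / ((a_tilde (a i) \<bullet> y (Suc k) - b_vec a r $ i)\<^sup>2 + \<epsilon>\<^sup>2)"
  using assms by (simp add: SR_IRLS_def)

lemma SR_IRLS_weights_pos:
  assumes "\<epsilon> > 0" and "SR_IRLS a r \<epsilon> y w"
  shows "w (Suc k) $ i > 0"
  unfolding SR_IRLS_weights[OF assms(2)] using assms(1) by (simp add: add_nonneg_pos)

lemma SR_IRLS_feasible:
  assumes "SR_IRLS a r \<epsilon> y w"
  shows "constraint_fun (y (Suc k)) = 0"
  using assms by (simp add: SR_IRLS_def is_arg_min_def)

text \<open>
  Comparison with an arbitrary feasible \<open>z\<close> yields both descent (\<open>z\<close> the current iterate) and
  optimality of limit points (\<open>z\<close> fixed).
\<close>

lemma step_bound: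
  assumes "\<epsilon> > 0" and run: "SR_IRLS a r \<epsilon> y w" and "constraint_fun z = 0"
  shows "robust_loss a r \<epsilon> (y (Suc (Suc k))) \<le> J_obj a r \<epsilon> z (w (Suc k))"
proof -
  have "is_arg_min (wls_cost a r (w (Suc k))) (\<lambda>z. constraint_fun z = 0) (y (Suc (Suc k)))"
    using run unfolding SR_IRLS_def by (metis diff_Suc_1 le_add1 plus_1_eq_Suc)
  then have "wls_cost a r (w (Suc k)) (y (Suc (Suc k))) \<le> wls_cost a r (w (Suc k)) z"
    using assms(3) by (simp add: is_arg_min_linorder)
  then have "J_obj a r \<epsilon> (y (Suc (Suc k))) (w (Suc k)) \<le> J_obj a r \<epsilon> z (w (Suc k))"
    by (simp add: J_obj_eq_wls_cost)
  with weights_majorize[OF assms(1) SR_IRLS_weights_pos[OF assms(1) run]] show ?thesis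
    by (rule order_trans)
qed

theorem theorem3:
  fixes a :: "'r::finite \<Rightarrow> real ^ 'n"
    and r :: "'r \<Rightarrow> real"
    and \<epsilon> :: real
    and y :: "nat \<Rightarrow> real ^ ('n + 1)"
    and w :: "nat \<Rightarrow> real ^ 'r"
  assumes "\<And>i. r i > 0"
    and "\<epsilon> > 0"
    and "SR_IRLS a r \<epsilon> y w"
  shows "convergent (\<lambda>k. J_obj a r \<epsilon> (y (Suc k)) (w (Suc k))) \<and>
         (\<forall>y' w'. seq_limit_point (\<lambda>k. (y (Suc k), w (Suc k))) (y', w') \<longrightarrow>
                  stationary_point a r \<epsilon> y' w')"
proof -
  note run = assms(3) and eps = assms(2)
  define X where "X k = robust_loss a r \<epsilon> (y (Suc k))" for k
  have J_X: "J_obj a r \<epsilon> (y (Suc k)) (w (Suc k)) = X k" for k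
    unfolding X_def by (rule reweighting_attains[OF eps SR_IRLS_weights[OF run]])
  have "X (Suc k) \<le> X k" for k
    using step_bound[OF eps run SR_IRLS_feasible[OF run], of k k] by (simp add: J_X X_def)
  then have "decseq X"
    by (rule decseq_SucI)
  moreover have "\<forall>k. (\<Sum>i\<in>(UNIV::'r set). 1 + ln (\<epsilon>\<^sup>2)) \<le> X k"
    unfolding X_def using robust_loss_ge[OF eps] by blast
  ultimately obtain L where L: "X \<longlonglongrightarrow> L" and L_le: "\<And>k. L \<le> X k"
    using decseq_convergent by metis
  have "stationary_point a r \<epsilon> y' w'"
    if limit: "seq_limit_point (\<lambda>k. (y (Suc k), w (Suc k))) (y', w')" for y' w'
  proof -
    obtain s where s: "strict_mono s"
      and lim: "(\<lambda>k. (y (Suc (s k)), w (Suc (s k)))) \<longlonglongrightarrow> (y', w')"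
      using limit by (auto simp: seq_limit_point_def o_def)
    have y_lim: "(\<lambda>k. y (Suc (s k))) \<longlonglongrightarrow> y'" and w_lim: "(\<lambda>k. w (Suc (s k))) \<longlonglongrightarrow> w'"
      using tendsto_fst[OF lim] tendsto_snd[OF lim] by simp_all
    have pos: "(a_tilde (a i) \<bullet> z - b_vec a r $ i)\<^sup>2 + \<epsilon>\<^sup>2 > 0" for i z
      using eps by (simp add: add_nonneg_pos)
    have w'_eq: "w' $ i = 1 / ((a_tilde (a i) \<bullet> y' - b_vec a r $ i)\<^sup>2 + \<epsilon>\<^sup>2)" for i
    proof (rule LIMSEQ_unique)
      show "(\<lambda>k. w (Suc (s k)) $ i) \<longlonglongrightarrow> w' $ i"
        by (intro tendsto_intros w_lim)
      show "(\<lambda>k. w (Suc (s k)) $ i) \<longlonglongrightarrow> 1 / ((a_tilde (a i) \<bullet> y' - b_vec a r $ i)\<^sup>2 + \<epsilon>\<^sup>2)"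
        unfolding SR_IRLS_weights[OF run]
        by (intro tendsto_intros y_lim less_imp_neq[OF pos, symmetric])
    qed
    then have w'_pos: "w' $ i > 0" for i
      using pos by simp
    have D_lim: "(\<lambda>k. D_mat *v y (Suc (s k))) \<longlonglongrightarrow> D_mat *v y'"
      by (rule bounded_linear.tendsto[OF matrix_vector_mul_bounded_linear y_lim])
    have "(\<lambda>k. constraint_fun (y (Suc (s k)))) \<longlonglongrightarrow> constraint_fun y'"
      unfolding constraint_fun_def by (intro tendsto_intros y_lim D_lim)
    then have feas: "constraint_fun y' = 0"
      by (simp add: SR_IRLS_feasible[OF run] LIMSEQ_const_iff)
    have "(\<lambda>k. X (s k)) \<longlonglongrightarrow> robust_loss a r \<epsilon> y'"
      unfolding X_def robust_loss_def
      by (intro tendsto_intros y_lim less_imp_neq[OF pos, symmetric])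
    moreover have "(\<lambda>k. X (s k)) \<longlonglongrightarrow> L"
      using LIMSEQ_subseq_LIMSEQ[OF L s] by (simp add: o_def)
    ultimately have "robust_loss a r \<epsilon> y' = L"
      by (rule LIMSEQ_unique)
    then have J': "J_obj a r \<epsilon> y' w' = L"
      using reweighting_attains[OF eps w'_eq] by simp
    have "J_obj a r \<epsilon> y' w' \<le> J_obj a r \<epsilon> z w'" if z: "constraint_fun z = 0" for z
    proof (rule LIMSEQ_le_const)
      show "(\<lambda>k. J_obj a r \<epsilon> z (w (Suc (s k)))) \<longlonglongrightarrow> J_obj a r \<epsilon> z w'"
        unfolding J_obj_def
        by (intro tendsto_intros w_lim less_imp_neq[OF w'_pos, symmetric])
      have "L \<le> J_obj a r \<epsilon> z (w (Suc k))" for k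
        using L_le[of "Suc k"] step_bound[OF eps run z, of k] by (simp add: X_def)
      then show "\<exists>N. \<forall>k\<ge>N. J_obj a r \<epsilon> y' w' \<le> J_obj a r \<epsilon> z (w (Suc (s k)))"
        by (simp add: J')
    qed
    then have "\<exists>\<mu>. transpose (A_mat a) *v (diag_mat w' *v (A_mat a *v y' - b_vec a r))
              + \<mu> *\<^sub>R (D_mat *v y' + f_vec) = 0"
      by (rule constrained_minimizer_multiplier[OF feas])
    then show ?thesis
      unfolding stationary_point_iff feasible_def using feas w'_pos w'_eq by simp
  qed
  moreover have "convergent (\<lambda>k. J_obj a r \<epsilon> (y (Suc k)) (w (Suc k)))"
    unfolding J_X using L by (rule convergentI)
  ultimately show ?thesis
    by blast
qed

end
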